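(* Let $(X,d)$ and $(Y,d')$ be two metric spaces. Then the product $(X\times Y,d\times d')$ is biLipschitz equivalent to a snowflake if and only if both $(X,d)$ and $(Y,d')$ are biLipschitz equivalent to a snowflake.
   Context: A metric space $(X,d)$ is an $\alpha$-snowflake, $\alpha\in(0,1)$, if there is a metric space $(Y,\rho)$ with $(X,d)=(Y,\rho^\alpha)$; it is a snowflake if it is an $\alpha$-snowflake for some $\alpha\in(0,1)$. A map $f\colon(X,d)\to(Y,d')$ is biLipschitz if there is $C\ge1$ with $C^{-1}d(x,x')\le d'(f(x),f(x'))\le C\,d(x,x')$ for all $x,x'\in X$. Two metric spaces are biLipschitz equivalent if there is a surjective biLipschitz map from one onto the other. The product metric $d\times d'$ is the $\ell^2$-product: $(d\times d')((x,y),(x',y'))=\sqrt{d(x,x')^2+d'(y,y')^2}$. *)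

theory Defs
  imports "HOL-Analysis.Analysis"
begin

text \<open>
  A metric space is a carrier set with a distance function satisfying \<^locale>\<open>Metric_space\<close>.
  Values of a distance function outside the carrier are irrelevant, so the equality
  \<open>(X, d) = (Y, \<rho>\<^sup>\<alpha>)\<close> means equality of the carriers and agreement of the distances on the carrier.
\<close>

definition snowflake_exp :: "real \<Rightarrow> 'a set \<Rightarrow> ('a \<Rightarrow> 'a \<Rightarrow> real) \<Rightarrow> bool" where
  "snowflake_exp \<alpha> X d \<longleftrightarrow>
     0 < \<alpha> \<and> \<alpha> < 1 \<and> Metric_space X d \<and>
     (\<exists>Y \<rho>. Metric_space Y \<rho> \<and> X = Y \<and> (\<forall>x\<in>X. \<forall>x'\<in>X. d x x' = \<rho> x x' powr \<alpha>))"

definition snowflake :: "'a set \<Rightarrow> ('a \<Rightarrow> 'a \<Rightarrow> real) \<Rightarrow> bool" where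
  "snowflake X d \<longleftrightarrow> (\<exists>\<alpha>. snowflake_exp \<alpha> X d)"

definition biLipschitz_map ::
  "'a set \<Rightarrow> ('a \<Rightarrow> 'a \<Rightarrow> real) \<Rightarrow> 'b set \<Rightarrow> ('b \<Rightarrow> 'b \<Rightarrow> real) \<Rightarrow> ('a \<Rightarrow> 'b) \<Rightarrow> bool" where
  "biLipschitz_map X d Y d' f \<longleftrightarrow>
     f \<in> X \<rightarrow> Y \<and>
     (\<exists>C\<ge>1. \<forall>x\<in>X. \<forall>x'\<in>X. inverse C * d x x' \<le> d' (f x) (f x') \<and> d' (f x) (f x') \<le> C * d x x')"

definition biLipschitz_equivalent ::
  "'a set \<Rightarrow> ('a \<Rightarrow> 'a \<Rightarrow> real) \<Rightarrow> 'b set \<Rightarrow> ('b \<Rightarrow> 'b \<Rightarrow> real) \<Rightarrow> bool" where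
  "biLipschitz_equivalent X d Y d' \<longleftrightarrow> (\<exists>f. biLipschitz_map X d Y d' f \<and> f ` X = Y)"

text \<open>
  HOL cannot quantify existentially over the type of the points of the snowflake, so the snowflake
  is sought in the type of the given space. This is no restriction: see
  \<open>biLipschitz_equivalent_to_snowflakeI\<close> below, where the snowflake lives in an arbitrary type.
\<close>

definition biLipschitz_equivalent_to_snowflake ::
  "'a set \<Rightarrow> ('a \<Rightarrow> 'a \<Rightarrow> real) \<Rightarrow> bool" where
  "biLipschitz_equivalent_to_snowflake X d \<longleftrightarrow>
     (\<exists>(Z :: 'a set) e. snowflake Z e \<and> biLipschitz_equivalent X d Z e)"

lemma biLipschitz_equivalent_to_snowflakeI:
  fixes X :: "'a set" and Z :: "'c set"
  assumes X: "Metric_space X d" and Z: "snowflake Z e" and eq: "biLipschitz_equivalent X d Z e"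
  shows "biLipschitz_equivalent_to_snowflake X d"
proof -
  obtain f C where fZ: "f \<in> X \<rightarrow> Z" and C: "C \<ge> 1"
    and bd: "\<And>x x'. x \<in> X \<Longrightarrow> x' \<in> X \<Longrightarrow>
      inverse C * d x x' \<le> e (f x) (f x') \<and> e (f x) (f x') \<le> C * d x x'"
    using eq unfolding biLipschitz_equivalent_def biLipschitz_map_def by metis
  obtain \<alpha> \<rho> where \<alpha>: "0 < \<alpha>" "\<alpha> < 1" and e: "Metric_space Z e" and \<rho>: "Metric_space Z \<rho>"
    and e\<rho>: "\<And>z z'. z \<in> Z \<Longrightarrow> z' \<in> Z \<Longrightarrow> e z z' = \<rho> z z' powr \<alpha>"
    using Z unfolding snowflake_def snowflake_exp_def by metis
  have inj: "x = x'" if "x \<in> X" "x' \<in> X" "f x = f x'" for x x'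
  proof -
    have "e (f x) (f x') = 0" using that fZ Metric_space.zero[OF e] by (auto simp: Pi_iff)
    then have "inverse C * d x x' \<le> 0" using bd that by metis
    then have "d x x' \<le> 0" using C by (simp add: mult_le_0_iff)
    then show ?thesis
      using Metric_space.zero[OF X] Metric_space.nonneg[OF X] that by (metis order_antisym)
  qed
  have pull: "Metric_space X (\<lambda>x x'. m (f x) (f x'))" if "Metric_space Z m" for m
  proof -
    interpret Metric_space Z m by fact
    show ?thesis
      by unfold_locales (use fZ inj in \<open>auto simp: Pi_iff commute intro: triangle\<close>)
  qed
  let ?e = "\<lambda>x x'. e (f x) (f x')"
  have "snowflake X ?e"
    unfolding snowflake_def snowflake_exp_def
    using \<alpha> pull[OF e] pull[OF \<rho>] e\<rho> fZ
    by (intro exI[of _ \<alpha>] conjI exI[of _ X] exI[of _ "\<lambda>x x'. \<rho> (f x) (f x')"]) (auto simp: Pi_iff)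
  moreover have "biLipschitz_equivalent X d X ?e"
    unfolding biLipschitz_equivalent_def biLipschitz_map_def
    using C bd by (intro exI[of _ "\<lambda>x. x"]) auto
  ultimately show ?thesis
    unfolding biLipschitz_equivalent_to_snowflake_def by blast
qed

end

theory Submission
  imports Defs
begin

text \<open>
  Up to a biLipschitz change, being a snowflake is a property of the distance alone, with no
  second space involved: it says that \<open>d\<close> is bounded above and below by constant multiples of
  \<open>\<rho>\<^sup>\<alpha>\<close> for some metric \<open>\<rho>\<close> on the same points and some \<open>0 < \<alpha> < 1\<close>
  (\<open>biLipschitz_equivalent_to_snowflake_iff\<close>). Two facts about this property give the theorem.

  First, it passes back along biLipschitz maps, which need not be surjective, because \<open>\<rho>\<close> can be
  pulled back (\<open>comparable_to_snowflake_pullback\<close>). Since each factor embeds isometrically into the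
  product as a slice \<open>X \<times> {y}\<close> or \<open>{x} \<times> Y\<close>, both factors inherit it from the product.
  Choosing a slice takes a point of the other factor, hence the nonemptiness hypotheses.

  Second, if both factors have the property with the \<^emph>\<open>same\<close> exponent \<open>\<alpha>\<close>, then so does the product,
  since raising to the power \<open>\<alpha>\<close> commutes with forming the product metric up to a constant
  (\<open>comparable_to_snowflake_prod\<close>). Different exponents \<open>\<alpha> \<le> \<beta>\<close> are reconciled by writing
  \<open>\<rho>\<^sup>\<alpha> = (\<rho>\<^bsup>\<alpha>/\<beta>\<^esup>)\<^sup>\<beta>\<close>, where \<open>\<rho>\<^bsup>\<alpha>/\<beta>\<^esup>\<close> is again a metric
  (\<open>comparable_to_snowflake_mono\<close>). The one analytic input is the subadditivity of
  \<open>t \<mapsto> t\<^sup>\<alpha>\<close> for \<open>\<alpha> \<le> 1\<close>.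
\<close>

text \<open>
  After dividing by \<open>a + b\<close>, this is \<open>1 = s + t \<le> s\<^sup>\<alpha> + t\<^sup>\<alpha>\<close> for fractions \<open>s, t\<close> in
  the unit interval, where lowering the exponent from \<open>1\<close> to \<open>\<alpha>\<close> increases the value.
\<close>

lemma powr_subadditive:
  fixes a b \<alpha> :: real
  assumes "0 \<le> a" "0 \<le> b" "\<alpha> \<le> 1"
  shows "(a + b) powr \<alpha> \<le> a powr \<alpha> + b powr \<alpha>"
proof (cases "a + b = 0")
  case True
  then show ?thesis using assms by simp
next
  case False
  then have pos: "a + b > 0" using assms by simp
  have frac: "t / (a + b) * (a + b) powr \<alpha> \<le> t powr \<alpha>" if "0 \<le> t" "t \<le> a + b" for t
  proof (cases "t = 0")
    case False
    have "t / (a + b) = (t / (a + b)) powr 1"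
      using that pos by simp
    also have "\<dots> \<le> (t / (a + b)) powr \<alpha>"
      using that pos False assms by (intro powr_mono') auto
    finally have "t / (a + b) * (a + b) powr \<alpha> \<le> (t / (a + b)) powr \<alpha> * (a + b) powr \<alpha>"
      by (rule mult_right_mono) simp
    also have "\<dots> = t powr \<alpha>"
      using that pos by (simp add: powr_divide)
    finally show ?thesis .
  qed simp
  have "(a + b) powr \<alpha> = a / (a + b) * (a + b) powr \<alpha> + b / (a + b) * (a + b) powr \<alpha>"
    using pos by (simp flip: distrib_right add_divide_distrib)
  also have "\<dots> \<le> a powr \<alpha> + b powr \<alpha>"
    using assms by (intro add_mono frac) auto
  finally show ?thesis .
qed

lemma Metric_space_powr:
  assumes "Metric_space X \<rho>" "0 < \<alpha>" "\<alpha> \<le> 1"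
  shows "Metric_space X (\<lambda>x y. \<rho> x y powr \<alpha>)"
proof -
  interpret Metric_space X \<rho> by fact
  show ?thesis
  proof
    fix x y z assume xyz: "x \<in> X" "y \<in> X" "z \<in> X"
    have "\<rho> x z powr \<alpha> \<le> (\<rho> x y + \<rho> y z) powr \<alpha>"
      using assms triangle[OF xyz] by (intro powr_mono2) auto
    also have "\<dots> \<le> \<rho> x y powr \<alpha> + \<rho> y z powr \<alpha>"
      using assms by (intro powr_subadditive) auto
    finally show "\<rho> x z powr \<alpha> \<le> \<rho> x y powr \<alpha> + \<rho> y z powr \<alpha>" .
  qed (auto simp: commute)
qed

definition comparable_to_snowflake :: "real \<Rightarrow> 'a set \<Rightarrow> ('a \<Rightarrow> 'a \<Rightarrow> real) \<Rightarrow> bool" where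
  "comparable_to_snowflake \<alpha> X d \<longleftrightarrow> 0 < \<alpha> \<and> \<alpha> < 1 \<and>
     (\<exists>\<rho> C. Metric_space X \<rho> \<and> C \<ge> 1 \<and>
       (\<forall>x\<in>X. \<forall>x'\<in>X. d x x' \<le> C * \<rho> x x' powr \<alpha> \<and> \<rho> x x' powr \<alpha> \<le> C * d x x'))"

lemma biLipschitz_map_inj_on:
  assumes "Metric_space X d" "Metric_space Z e" "biLipschitz_map X d Z e f"
  shows "inj_on f X"
proof (rule inj_onI)
  interpret X: Metric_space X d by fact
  interpret Z: Metric_space Z e by fact
  fix x x' assume x: "x \<in> X" "x' \<in> X" and eq: "f x = f x'"
  obtain C where "C \<ge> 1" "inverse C * d x x' \<le> e (f x) (f x')" "f x \<in> Z"
    using assms(3) x unfolding biLipschitz_map_def by blast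
  then have "d x x' \<le> 0" using eq by (simp add: mult_le_0_iff)
  then show "x = x'" using x X.zero X.nonneg by (metis order_antisym)
qed

text \<open>
  If \<open>e\<close> is comparable to \<open>\<rho>\<^sup>\<alpha>\<close> on \<open>Z\<close>, then \<open>d\<close> is comparable to the pullback of \<open>\<rho>\<^sup>\<alpha>\<close>, with the
  product of the two constants. The pullback of \<open>\<rho>\<close> is a metric because biLipschitz maps are
  injective.
\<close>

lemma comparable_to_snowflake_pullback:
  assumes X: "Metric_space X d" and Z: "Metric_space Z e"
    and f: "biLipschitz_map X d Z e f" and snow: "comparable_to_snowflake \<alpha> Z e"
  shows "comparable_to_snowflake \<alpha> X d"
proof -
  obtain C where fZ: "f \<in> X \<rightarrow> Z" and C: "C \<ge> 1"
    and bd: "\<And>x x'. x \<in> X \<Longrightarrow> x' \<in> X \<Longrightarrow>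
      inverse C * d x x' \<le> e (f x) (f x') \<and> e (f x) (f x') \<le> C * d x x'"
    using f unfolding biLipschitz_map_def by metis
  obtain \<rho> K where \<alpha>: "0 < \<alpha>" "\<alpha> < 1" and \<rho>: "Metric_space Z \<rho>" and K: "K \<ge> 1"
    and cmp: "\<And>z z'. z \<in> Z \<Longrightarrow> z' \<in> Z \<Longrightarrow>
      e z z' \<le> K * \<rho> z z' powr \<alpha> \<and> \<rho> z z' powr \<alpha> \<le> K * e z z'"
    using snow unfolding comparable_to_snowflake_def by metis
  let ?\<rho> = "\<lambda>x x'. \<rho> (f x) (f x')"
  interpret Metric_space Z \<rho> by fact
  have "Metric_space X ?\<rho>"
    using fZ inj_onD[OF biLipschitz_map_inj_on[OF X Z f]]
    by unfold_locales (auto simp: Pi_iff commute intro: triangle)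
  moreover have "d x x' \<le> C * K * ?\<rho> x x' powr \<alpha> \<and> ?\<rho> x x' powr \<alpha> \<le> C * K * d x x'"
    if x: "x \<in> X" "x' \<in> X" for x x'
  proof
    have fx: "f x \<in> Z" "f x' \<in> Z" using fZ x by auto
    have "d x x' \<le> C * e (f x) (f x')"
      using bd[OF x] C by (simp add: field_simps)
    also have "\<dots> \<le> C * (K * ?\<rho> x x' powr \<alpha>)"
      using cmp[OF fx] C by (intro mult_left_mono) auto
    finally show "d x x' \<le> C * K * ?\<rho> x x' powr \<alpha>" by (simp add: mult.assoc)
    have "?\<rho> x x' powr \<alpha> \<le> K * e (f x) (f x')"
      using cmp[OF fx] by simp
    also have "\<dots> \<le> K * (C * d x x')"
      using bd[OF x] K by (intro mult_left_mono) auto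
    finally show "?\<rho> x x' powr \<alpha> \<le> C * K * d x x'" by (simp add: ac_simps)
  qed
  moreover have "C * K \<ge> 1"
    using mult_mono[of 1 C 1 K] C K by simp
  ultimately show ?thesis
    using \<alpha> unfolding comparable_to_snowflake_def by blast
qed

lemma snowflake_exp_imp_comparable:
  "snowflake_exp \<alpha> Z e \<Longrightarrow> comparable_to_snowflake \<alpha> Z e"
  unfolding snowflake_exp_def comparable_to_snowflake_def by force

text \<open>
  From left to right, pull the metric back from the snowflake. From right to left, \<open>\<rho>\<^sup>\<alpha>\<close> is itself a
  metric on \<open>X\<close>, and the identity map is biLipschitz onto the snowflake \<open>(X, \<rho>\<^sup>\<alpha>)\<close>.
\<close>

lemma biLipschitz_equivalent_to_snowflake_iff:
  assumes X: "Metric_space X d"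
  shows "biLipschitz_equivalent_to_snowflake X d \<longleftrightarrow> (\<exists>\<alpha>. comparable_to_snowflake \<alpha> X d)"
proof
  assume "biLipschitz_equivalent_to_snowflake X d"
  then obtain Z :: "'a set" and e \<alpha> f where "snowflake_exp \<alpha> Z e" "biLipschitz_map X d Z e f"
    unfolding biLipschitz_equivalent_to_snowflake_def biLipschitz_equivalent_def snowflake_def
    by blast
  moreover from this have "Metric_space Z e" by (simp add: snowflake_exp_def)
  ultimately show "\<exists>\<alpha>. comparable_to_snowflake \<alpha> X d"
    using comparable_to_snowflake_pullback[OF X] snowflake_exp_imp_comparable by blast
next
  assume "\<exists>\<alpha>. comparable_to_snowflake \<alpha> X d"
  then obtain \<alpha> \<rho> C where \<alpha>: "0 < \<alpha>" "\<alpha> < 1" and \<rho>: "Metric_space X \<rho>" and C: "C \<ge> 1"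
    and cmp: "\<And>x x'. x \<in> X \<Longrightarrow> x' \<in> X \<Longrightarrow>
      d x x' \<le> C * \<rho> x x' powr \<alpha> \<and> \<rho> x x' powr \<alpha> \<le> C * d x x'"
    unfolding comparable_to_snowflake_def by metis
  let ?e = "\<lambda>x x'. \<rho> x x' powr \<alpha>"
  have "snowflake X ?e"
    unfolding snowflake_def snowflake_exp_def
    using \<alpha> \<rho> Metric_space_powr[OF \<rho>, of \<alpha>] by auto
  moreover have "biLipschitz_map X d X ?e (\<lambda>x. x)"
    unfolding biLipschitz_map_def using C cmp
    by (intro conjI exI[of _ C]) (auto simp: field_simps)
  then have "biLipschitz_equivalent X d X ?e"
    unfolding biLipschitz_equivalent_def by (intro exI[of _ "\<lambda>x. x"]) auto
  ultimately show "biLipschitz_equivalent_to_snowflake X d"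
    unfolding biLipschitz_equivalent_to_snowflake_def by blast
qed

lemma comparable_to_snowflake_mono:
  assumes "comparable_to_snowflake \<alpha> X d" "\<alpha> \<le> \<beta>" "\<beta> < 1"
  shows "comparable_to_snowflake \<beta> X d"
proof -
  obtain \<rho> C where \<alpha>: "0 < \<alpha>" and \<rho>: "Metric_space X \<rho>" and C: "C \<ge> 1"
    and cmp: "\<forall>x\<in>X. \<forall>x'\<in>X. d x x' \<le> C * \<rho> x x' powr \<alpha> \<and> \<rho> x x' powr \<alpha> \<le> C * d x x'"
    using assms(1) unfolding comparable_to_snowflake_def by blast
  have "Metric_space X (\<lambda>x x'. \<rho> x x' powr (\<alpha> / \<beta>))"
    using \<alpha> assms by (intro Metric_space_powr \<rho>) auto
  moreover have "(\<rho> x x' powr (\<alpha> / \<beta>)) powr \<beta> = \<rho> x x' powr \<alpha>" for x x'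
    using \<alpha> assms by (simp add: powr_powr)
  ultimately show ?thesis
    unfolding comparable_to_snowflake_def using \<alpha> assms C cmp
    by (intro conjI exI[of _ "\<lambda>x x'. \<rho> x x' powr (\<alpha> / \<beta>)"] exI[of _ C]) auto
qed

text \<open>
  Writing \<open>a, b\<close> for the distances in the two factors and \<open>P\<close> for the product distance, everything
  follows from \<open>max a b \<le> P \<le> a + b\<close>, once for \<open>d, d'\<close> and once for the metrics \<open>\<rho>, \<rho>'\<close>:
  the upper bound on \<open>P\<^sup>\<alpha>\<close> uses the subadditivity of the power, the lower bound its monotonicity.
\<close>

lemma comparable_to_snowflake_prod:
  assumes X: "Metric_space X d" and Y: "Metric_space Y d'"
    and snowX: "comparable_to_snowflake \<alpha> X d" and snowY: "comparable_to_snowflake \<alpha> Y d'"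
  shows "comparable_to_snowflake \<alpha> (X \<times> Y) (prod_dist d d')"
proof -
  obtain \<rho> C where \<alpha>: "0 < \<alpha>" "\<alpha> < 1" and \<rho>: "Metric_space X \<rho>" and C: "C \<ge> 1"
    and cmp: "\<And>x x'. x \<in> X \<Longrightarrow> x' \<in> X \<Longrightarrow>
      d x x' \<le> C * \<rho> x x' powr \<alpha> \<and> \<rho> x x' powr \<alpha> \<le> C * d x x'"
    using snowX unfolding comparable_to_snowflake_def by metis
  obtain \<rho>' C' where \<rho>': "Metric_space Y \<rho>'" and C': "C' \<ge> 1"
    and cmp': "\<And>y y'. y \<in> Y \<Longrightarrow> y' \<in> Y \<Longrightarrow>
      d' y y' \<le> C' * \<rho>' y y' powr \<alpha> \<and> \<rho>' y y' powr \<alpha> \<le> C' * d' y y'"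
    using snowY unfolding comparable_to_snowflake_def by metis
  interpret d: Metric_space12 X d Y d' using X Y by (simp add: Metric_space12_def)
  interpret \<rho>: Metric_space12 X \<rho> Y \<rho>' using \<rho> \<rho>' by (simp add: Metric_space12_def)
  have "prod_dist d d' (x, y) (x', y') \<le> (C + C') * prod_dist \<rho> \<rho>' (x, y) (x', y') powr \<alpha> \<and>
        prod_dist \<rho> \<rho>' (x, y) (x', y') powr \<alpha> \<le> (C + C') * prod_dist d d' (x, y) (x', y')"
    (is "?D \<le> _ * ?P powr \<alpha> \<and> _")
    if x: "x \<in> X" "x' \<in> X" and y: "y \<in> Y" "y' \<in> Y" for x x' y y'
  proof
    have "?D \<le> d x x' + d' y y'"
      using x y by (intro d.prod_metric_le_components) auto
    also have "\<dots> \<le> C * \<rho> x x' powr \<alpha> + C' * \<rho>' y y' powr \<alpha>"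
      using cmp[OF x] cmp'[OF y] by (intro add_mono) auto
    also have "\<dots> \<le> C * ?P powr \<alpha> + C' * ?P powr \<alpha>"
      using \<alpha> C C' by (intro add_mono mult_left_mono powr_mono2 \<rho>.component_le_prod_metric) auto
    finally show "?D \<le> (C + C') * ?P powr \<alpha>" by (simp add: distrib_right)
    have "?P powr \<alpha> \<le> (\<rho> x x' + \<rho>' y y') powr \<alpha>"
      using \<alpha> x y by (intro powr_mono2 \<rho>.prod_metric_le_components \<rho>.Prod_metric.nonneg) auto
    also have "\<dots> \<le> \<rho> x x' powr \<alpha> + \<rho>' y y' powr \<alpha>"
      using \<alpha> by (intro powr_subadditive) auto
    also have "\<dots> \<le> C * d x x' + C' * d' y y'"
      using cmp[OF x] cmp'[OF y] by (intro add_mono) auto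
    also have "\<dots> \<le> C * ?D + C' * ?D"
      using C C' by (intro add_mono mult_left_mono d.component_le_prod_metric) auto
    finally show "?P powr \<alpha> \<le> (C + C') * ?D" by (simp add: distrib_right)
  qed
  then have "\<forall>p\<in>X \<times> Y. \<forall>p'\<in>X \<times> Y.
      prod_dist d d' p p' \<le> (C + C') * prod_dist \<rho> \<rho>' p p' powr \<alpha> \<and>
      prod_dist \<rho> \<rho>' p p' powr \<alpha> \<le> (C + C') * prod_dist d d' p p'"
    by (simp add: Ball_def split_paired_all)
  moreover have "C + C' \<ge> 1" using C C' by simp
  ultimately show ?thesis
    unfolding comparable_to_snowflake_def using \<alpha> \<rho>.prod_metric
    by (intro conjI exI[of _ "prod_dist \<rho> \<rho>'"] exI[of _ "C + C'"])
qed

lemma biLipschitz_map_slices: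
  assumes "Metric_space X d" "Metric_space Y d'"
  shows "y \<in> Y \<Longrightarrow> biLipschitz_map X d (X \<times> Y) (prod_dist d d') (\<lambda>x. (x, y))"
    and "x \<in> X \<Longrightarrow> biLipschitz_map Y d' (X \<times> Y) (prod_dist d d') (\<lambda>y. (x, y))"
proof -
  interpret X: Metric_space X d by fact
  interpret Y: Metric_space Y d' by fact
  show "biLipschitz_map X d (X \<times> Y) (prod_dist d d') (\<lambda>x. (x, y))" if "y \<in> Y"
    unfolding biLipschitz_map_def using that
    by (intro conjI exI[of _ 1]) (auto simp: prod_dist_def)
  show "biLipschitz_map Y d' (X \<times> Y) (prod_dist d d') (\<lambda>y. (x, y))" if "x \<in> X"
    unfolding biLipschitz_map_def using that
    by (intro conjI exI[of _ 1]) (auto simp: prod_dist_def)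
qed

theorem proposition5p4:
  fixes X :: "'a set" and d :: "'a \<Rightarrow> 'a \<Rightarrow> real"
    and Y :: "'b set" and d' :: "'b \<Rightarrow> 'b \<Rightarrow> real"
  assumes "Metric_space X d" and "X \<noteq> {}"
    and "Metric_space Y d'" and "Y \<noteq> {}"
  shows "biLipschitz_equivalent_to_snowflake (X \<times> Y) (prod_dist d d') \<longleftrightarrow>
           biLipschitz_equivalent_to_snowflake X d \<and> biLipschitz_equivalent_to_snowflake Y d'"
proof -
  interpret Metric_space12 X d Y d' using assms by (simp add: Metric_space12_def)
  note XY = prod_metric
  obtain x\<^sub>0 y\<^sub>0 where pts: "x\<^sub>0 \<in> X" "y\<^sub>0 \<in> Y" using assms by blast
  have "(\<exists>\<alpha>. comparable_to_snowflake \<alpha> (X \<times> Y) (prod_dist d d')) \<longleftrightarrow>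
        (\<exists>\<alpha>. comparable_to_snowflake \<alpha> X d) \<and> (\<exists>\<beta>. comparable_to_snowflake \<beta> Y d')"
    (is "?L \<longleftrightarrow> ?R")
  proof
    assume ?L
    then show ?R
      using comparable_to_snowflake_pullback[OF assms(1) XY]
        comparable_to_snowflake_pullback[OF assms(3) XY]
        biLipschitz_map_slices[OF assms(1,3)] pts by blast
  next
    assume ?R
    then obtain \<alpha> \<beta> where snow: "comparable_to_snowflake \<alpha> X d" "comparable_to_snowflake \<beta> Y d'"
      by blast
    then have "max \<alpha> \<beta> < 1" by (simp add: comparable_to_snowflake_def)
    with snow have "comparable_to_snowflake (max \<alpha> \<beta>) X d" "comparable_to_snowflake (max \<alpha> \<beta>) Y d'"
      by (auto intro: comparable_to_snowflake_mono)
    then show ?L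
      using comparable_to_snowflake_prod assms(1,3) by blast
  qed
  then show ?thesis
    using assms(1,3) XY by (simp add: biLipschitz_equivalent_to_snowflake_iff)
qed

end
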